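(* (Blackall constraint.) Let $m>0$ and let $U$ be a smooth function of $\mathbf q=(q_1,q_2)\in\mathbb{R}^2$. Consider the mass point in $\mathbb{R}^3$ with Lagrangian $L=\frac12m(\dot q_1^2+\dot q_2^2+\dot q_3^2)-U(\mathbf q)$ and nonholonomic constraint $\dot q_3-q_1q_2\dot q_1=0$, i.e. $a_1=q_1q_2$, $a_2=0$. Then the relation $$\frac\partial{\partial q_1}\left(\frac{a_1}{1+a_1^2+a_2^2}\left(\frac{\partial a_1}{\partial q_2}-\frac{\partial a_2}{\partial q_1}\right)\right)+\frac\partial{\partial q_2}\left(\frac{a_2}{1+a_1^2+a_2^2}\left(\frac{\partial a_1}{\partial q_2}-\frac{\partial a_2}{\partial q_1}\right)\right)=0$$ does not hold identically, and the reduced system in the variables $(\mathbf q,\mathbf P)\in\mathbb{R}^4$ (see context) has no invariant measure $\mathcal N(\mathbf q)\,d\mathbf q\,d\mathbf P$ with smooth positive density $\mathcal N(\mathbf q)$ depending on the configuration variables only.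
   Context: For the constraint $\dot q_3=a_1(\mathbf q)\dot q_1+a_2(\mathbf q)\dot q_2$ let $L^*$ be $L$ with $\dot q_3$ eliminated by the constraint, $S=\left(\frac{\partial L}{\partial\dot q_3}\right)^{*}\left(\frac{\partial a_1}{\partial q_2}-\frac{\partial a_2}{\partial q_1}\right)$ (with $(\cdot)^*$ meaning that $\dot q_3$ is eliminated by the constraint after differentiation), $P_i=\partial L^*/\partial\dot q_i$ ($i=1,2$), $H=P_1\dot q_1+P_2\dot q_2-L^*$ as a function of $(\mathbf q,\mathbf P)$. The reduced system is $$\dot q_i=\frac{\partial H}{\partial P_i},\quad \dot P_1=-\frac{\partial H}{\partial q_1}+\frac{\partial H}{\partial P_2}S,\quad \dot P_2=-\frac{\partial H}{\partial q_2}-\frac{\partial H}{\partial P_1}S .$$ A measure $\mathcal N\,d\mathbf q\,d\mathbf P$ is invariant if $\operatorname{div}(\mathcal N\mathbf v)=0$ for the vector field $\mathbf v$ of this system. *)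

theory Defs
  imports "HOL-Analysis.Analysis"
begin

definition dir_deriv :: "'a::real_normed_vector \<Rightarrow> ('a \<Rightarrow> real) \<Rightarrow> 'a \<Rightarrow> real" where
  "dir_deriv b f x = deriv (\<lambda>t. f (x + t *\<^sub>R b)) 0"

definition partial :: "'n::finite \<Rightarrow> (real^'n \<Rightarrow> real) \<Rightarrow> real^'n \<Rightarrow> real" where
  "partial i f x = dir_deriv (axis i 1) f x"

definition divergence :: "('a::euclidean_space \<Rightarrow> 'a) \<Rightarrow> 'a \<Rightarrow> real" where
  "divergence F x = (\<Sum>b\<in>Basis. dir_deriv b (\<lambda>y. F y \<bullet> b) x)"

primrec C_k :: "nat \<Rightarrow> (real^'n::finite \<Rightarrow> real) \<Rightarrow> bool" where
  "C_k 0 f \<longleftrightarrow> continuous_on UNIV f"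
| "C_k (Suc k) f \<longleftrightarrow> f differentiable_on UNIV \<and> (\<forall>i. C_k k (partial i f))"

definition smooth :: "(real^'n::finite \<Rightarrow> real) \<Rightarrow> bool" where
  "smooth f \<longleftrightarrow> (\<forall>k. C_k k f)"

text \<open>
  In what follows a Lagrangian \<open>L q v\<close> depends on \<open>q = (q1, q2)\<close> and on all three velocities,
  and the constraint is \<open>v3 = a1 q * v1 + a2 q * v2\<close>.
\<close>

definition constrained_velocity ::
    "(real^2 \<Rightarrow> real) \<Rightarrow> (real^2 \<Rightarrow> real) \<Rightarrow> real^2 \<Rightarrow> real^2 \<Rightarrow> real^3" where
  "constrained_velocity a1 a2 q v = vector [v$1, v$2, a1 q * v$1 + a2 q * v$2]"

definition reduced_lagrangian ::
    "(real^2 \<Rightarrow> real^3 \<Rightarrow> real) \<Rightarrow> (real^2 \<Rightarrow> real) \<Rightarrow> (real^2 \<Rightarrow> real)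
      \<Rightarrow> real^2 \<Rightarrow> real^2 \<Rightarrow> real" where
  "reduced_lagrangian L a1 a2 q v = L q (constrained_velocity a1 a2 q v)"

definition nonholonomic_S ::
    "(real^2 \<Rightarrow> real^3 \<Rightarrow> real) \<Rightarrow> (real^2 \<Rightarrow> real) \<Rightarrow> (real^2 \<Rightarrow> real)
      \<Rightarrow> real^2 \<Rightarrow> real^2 \<Rightarrow> real" where
  "nonholonomic_S L a1 a2 q v =
     partial 3 (L q) (constrained_velocity a1 a2 q v) * (partial 2 a1 q - partial 1 a2 q)"

definition momentum ::
    "(real^2 \<Rightarrow> real^3 \<Rightarrow> real) \<Rightarrow> (real^2 \<Rightarrow> real) \<Rightarrow> (real^2 \<Rightarrow> real)
      \<Rightarrow> real^2 \<Rightarrow> real^2 \<Rightarrow> real^2" where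
  "momentum L a1 a2 q v = (\<chi> i. partial i (reduced_lagrangian L a1 a2 q) v)"

text \<open>
  The inverse Legendre transformation; meaningful when \<open>momentum L a1 a2 q\<close> is bijective
  for every \<open>q\<close>.
\<close>

definition velocity ::
    "(real^2 \<Rightarrow> real^3 \<Rightarrow> real) \<Rightarrow> (real^2 \<Rightarrow> real) \<Rightarrow> (real^2 \<Rightarrow> real)
      \<Rightarrow> real^2 \<Rightarrow> real^2 \<Rightarrow> real^2" where
  "velocity L a1 a2 q P = inv (momentum L a1 a2 q) P"

definition hamiltonian ::
    "(real^2 \<Rightarrow> real^3 \<Rightarrow> real) \<Rightarrow> (real^2 \<Rightarrow> real) \<Rightarrow> (real^2 \<Rightarrow> real)
      \<Rightarrow> real^2 \<Rightarrow> real^2 \<Rightarrow> real" where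
  "hamiltonian L a1 a2 q P =
     (let v = velocity L a1 a2 q P
      in P$1 * v$1 + P$2 * v$2 - reduced_lagrangian L a1 a2 q v)"

definition reduced_field ::
    "(real^2 \<Rightarrow> real^3 \<Rightarrow> real) \<Rightarrow> (real^2 \<Rightarrow> real) \<Rightarrow> (real^2 \<Rightarrow> real)
      \<Rightarrow> (real^2) \<times> (real^2) \<Rightarrow> (real^2) \<times> (real^2)" where
  "reduced_field L a1 a2 = (\<lambda>(q, P).
     let H = hamiltonian L a1 a2;
         S = nonholonomic_S L a1 a2 q (velocity L a1 a2 q P);
         H_q = (\<lambda>i. partial i (\<lambda>q'. H q' P) q);
         H_P = (\<lambda>i. partial i (H q) P)
     in (vector [H_P 1, H_P 2],
         vector [- H_q 1 + H_P 2 * S, - H_q 2 - H_P 1 * S]))"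

definition invariant_density :: "('a::euclidean_space \<Rightarrow> 'a) \<Rightarrow> ('a \<Rightarrow> real) \<Rightarrow> bool" where
  "invariant_density F N \<longleftrightarrow> (\<forall>x. divergence (\<lambda>y. N y *\<^sub>R F y) x = 0)"

end

theory Submission
  imports Defs
begin

text \<open>
  Put \<open>D = 1 + q1\<^sup>2 q2\<^sup>2\<close>. The divergence of \<open>N\<close> times the reduced field is
  \<open>(\<partial>\<^sub>1N) P1 / (m D) + (\<partial>\<^sub>2N + N q1\<^sup>2 q2 / D) P2 / m\<close>, the Hamiltonian part being divergence
  free. It vanishes for all \<open>P\<close> only if \<open>\<partial>\<^sub>1N = 0\<close> and \<open>\<partial>\<^sub>2N = - N q1\<^sup>2 q2 / D\<close>. By the first
  equation \<open>N\<close>, hence \<open>\<partial>\<^sub>2N\<close>, takes the same values at \<open>(0, 1)\<close> and \<open>(1, 1)\<close>; by the second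
  \<open>\<partial>\<^sub>2N\<close> is zero at the former point and \<open>- N / 2 < 0\<close> at the latter.
\<close>

section \<open>Directional derivatives and divergence in coordinates\<close>

lemma dir_deriv_eqI:
  assumes "((\<lambda>t. f (x + t *\<^sub>R b)) has_real_derivative d) (at 0)"
  shows "dir_deriv b f x = d"
  unfolding dir_deriv_def using assms by (rule DERIV_imp_deriv)

lemma partial_eqI:
  assumes "((\<lambda>t. f (x + t *\<^sub>R axis i 1)) has_real_derivative d) (at 0)"
  shows "partial i f x = d"
  unfolding partial_def using assms by (rule dir_deriv_eqI)

text \<open>The chain rule at an arbitrary parameter \<open>s\<close>, not only at 0, is what later
  allows integration along a whole line.\<close>

lemma has_real_derivative_along_line:
  fixes f :: "'a::real_normed_vector \<Rightarrow> real"
  assumes "f differentiable (at (x + s *\<^sub>R b))"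
  shows "((\<lambda>t. f (x + t *\<^sub>R b)) has_real_derivative dir_deriv b f (x + s *\<^sub>R b)) (at s)"
proof -
  obtain f' where f': "(f has_derivative f') (at (x + s *\<^sub>R b))"
    using assms by (auto simp: differentiable_def)
  have "linear f'"
    using f' by (rule has_derivative_linear)
  \<comment> \<open>Two instances follow: \<open>y = x + s *\<^sub>R b\<close>, \<open>r = 0\<close>
    identifies \<open>f' b\<close> as the directional derivative, and \<open>y = x\<close>,
    \<open>r = s\<close> gives the claim.\<close>
  have line: "((\<lambda>t. f (y + t *\<^sub>R b)) has_real_derivative f' b) (at r)"
    if "y + r *\<^sub>R b = x + s *\<^sub>R b" for y r
  proof -
    have "((\<lambda>t. y + t *\<^sub>R b) has_derivative (\<lambda>t. t *\<^sub>R b)) (at r)"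
      by (auto intro!: derivative_eq_intros)
    then have "((\<lambda>t. f (y + t *\<^sub>R b)) has_derivative (\<lambda>t. f' (t *\<^sub>R b))) (at r)"
      by (rule has_derivative_compose) (simp add: f' that)
    then show ?thesis
      by (simp add: has_field_derivative_def linear_scale[OF \<open>linear f'\<close>] mult_commute_abs)
  qed
  have "dir_deriv b f (x + s *\<^sub>R b) = f' b"
    by (rule dir_deriv_eqI, rule line) simp
  then show ?thesis
    using line[of x s] by simp
qed

lemma has_real_derivative_partial:
  assumes "f differentiable (at x)"
  shows "((\<lambda>t. f (x + t *\<^sub>R axis i 1)) has_real_derivative partial i f x) (at 0)"
  using has_real_derivative_along_line[of f x 0 "axis i 1"] assms
  by (simp add: partial_def)

lemma smooth_imp_differentiable:
  assumes "smooth f"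
  shows "f differentiable (at x)"
proof -
  have "C_k (Suc 0) f"
    using assms unfolding smooth_def by blast
  then show ?thesis
    by (simp add: differentiable_on_def)
qed

lemma vec2_eqI: "(x::real^2)$1 = y$1 \<Longrightarrow> x$2 = y$2 \<Longrightarrow> x = y"
  by (simp add: vec_eq_iff forall_2)

lemma axis_2_component [simp]:
  "(axis 1 c :: real^2)$1 = c" "(axis 1 c :: real^2)$2 = 0"
  "(axis 2 c :: real^2)$1 = 0" "(axis 2 c :: real^2)$2 = c"
  by (simp_all add: axis_def)

lemma axis_3_component [simp]:
  "(axis 3 c :: real^3)$1 = 0" "(axis 3 c :: real^3)$2 = 0" "(axis 3 c :: real^3)$3 = c"
  by (simp_all add: axis_def)

lemma divergence_phase_space:
  fixes F :: "(real^2) \<times> (real^2) \<Rightarrow> (real^2) \<times> (real^2)"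
  shows "divergence F x =
      dir_deriv (axis 1 1, 0) (\<lambda>y. fst (F y)$1) x + dir_deriv (axis 2 1, 0) (\<lambda>y. fst (F y)$2) x
    + dir_deriv (0, axis 1 1) (\<lambda>y. snd (F y)$1) x + dir_deriv (0, axis 2 1) (\<lambda>y. snd (F y)$2) x"
proof -
  have ne: "axis 1 1 \<noteq> (axis 2 1 :: real^2)"
    by (metis axis_2_component(1,3) zero_neq_one)
  have Basis: "(Basis :: (real^2) set) = {axis 1 1, axis 2 1}"
    by (auto simp: Basis_vec_def) (metis exhaust_2)
  show ?thesis
    unfolding divergence_def Basis_prod_def Basis
    using ne by (simp add: inner_prod_def inner_axis axis_eq_0_iff add.assoc)
qed

section \<open>The reduced system of the Blackall constraint and its divergence\<close>

locale blackall =
  fixes m :: real and U :: "real^2 \<Rightarrow> real"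
  assumes m_pos: "m > 0" and U_differentiable: "\<And>q. U differentiable (at q)"
begin

definition a :: "real^2 \<Rightarrow> real" where "a q = q$1 * q$2"

text \<open>Up to the factor \<open>m\<close>, the coefficient of the squared first velocity in
  twice the reduced kinetic energy.\<close>

definition D :: "real^2 \<Rightarrow> real" where "D q = 1 + (a q)\<^sup>2"

definition L :: "real^2 \<Rightarrow> real^3 \<Rightarrow> real" where
  "L q v = 1/2 * m * ((v$1)^2 + (v$2)^2 + (v$3)^2) - U q"

abbreviation zero :: "real^2 \<Rightarrow> real" where "zero \<equiv> (\<lambda>q. 0)"

lemma D_pos: "D q > 0"
  unfolding D_def by (simp add: add_pos_nonneg)

lemma D_nonzero [simp]: "D q \<noteq> 0"
  using D_pos[of q] by simp

lemma m_nonzero [simp]: "m \<noteq> 0"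
  using m_pos by simp

lemma reduced_lagrangian_eq:
  "reduced_lagrangian L a zero q v = 1/2 * m * (D q * (v$1)\<^sup>2 + (v$2)\<^sup>2) - U q"
  by (simp add: reduced_lagrangian_def L_def constrained_velocity_def D_def algebra_simps)

lemma momentum_eq: "momentum L a zero q v = vector [m * D q * v$1, m * v$2]"
proof (rule vec2_eqI)
  show "momentum L a zero q v $ 1 = (vector [m * D q * v$1, m * v$2] :: real^2) $ 1"
    unfolding momentum_def vec_lambda_beta vector_2
    by (rule partial_eqI) (auto simp: reduced_lagrangian_eq intro!: derivative_eq_intros)
  show "momentum L a zero q v $ 2 = (vector [m * D q * v$1, m * v$2] :: real^2) $ 2"
    unfolding momentum_def vec_lambda_beta vector_2
    by (rule partial_eqI) (auto simp: reduced_lagrangian_eq intro!: derivative_eq_intros)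
qed

text \<open>The momentum map is diagonal with nonzero entries \<open>m * D q\<close> and
  \<open>m\<close>, so it is injective and \<open>inv\<close> returns the explicit preimage.\<close>

lemma velocity_eq: "velocity L a zero q P = vector [P$1 / (m * D q), P$2 / m]"
  unfolding velocity_def
proof (rule inv_f_eq)
  show "inj (momentum L a zero q)"
  proof (rule injI)
    fix v w assume "momentum L a zero q v = momentum L a zero q w"
    then have "m * D q * v$1 = m * D q * w$1" "m * v$2 = m * w$2"
      unfolding momentum_eq by (metis vector_2)+
    then show "v = w"
      by (intro vec2_eqI) simp_all
  qed
  show "momentum L a zero q (vector [P$1 / (m * D q), P$2 / m]) = P"
    by (rule vec2_eqI) (simp_all add: momentum_eq)
qed

lemma hamiltonian_eq:
  "hamiltonian L a zero q P = (P$1)\<^sup>2 / (2 * m * D q) + (P$2)\<^sup>2 / (2 * m) + U q"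
  by (simp add: hamiltonian_def velocity_eq reduced_lagrangian_eq field_simps power2_eq_square)

lemma partial_a_2: "partial 2 a q = q$1"
  by (rule partial_eqI) (auto simp: a_def intro!: derivative_eq_intros)

lemma partial_zero: "partial i zero q = 0"
  by (rule partial_eqI) simp

lemma D_partial_1:
  "((\<lambda>t. D (q + t *\<^sub>R axis 1 1)) has_real_derivative 2 * q$1 * (q$2)\<^sup>2) (at 0)"
  by (auto simp: D_def a_def power2_eq_square intro!: derivative_eq_intros)

lemma D_partial_2:
  "((\<lambda>t. D (q + t *\<^sub>R axis 2 1)) has_real_derivative 2 * (q$1)\<^sup>2 * q$2) (at 0)"
  by (auto simp: D_def a_def power2_eq_square intro!: derivative_eq_intros)

text \<open>\<open>S\<close> is \<open>m * v$3 * q$1\<close>, and the constraint gives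
  \<open>v$3 = q$1 * q$2 * P$1 / (m * D q)\<close>; the mass cancels.\<close>

lemma nonholonomic_S_eq:
  "nonholonomic_S L a zero q (velocity L a zero q P) = (q$1)\<^sup>2 * q$2 * P$1 / D q"
proof -
  have "partial 3 (L q) v = m * v$3" for v
    by (rule partial_eqI) (auto simp: L_def intro!: derivative_eq_intros)
  then show ?thesis
    unfolding nonholonomic_S_def partial_a_2 partial_zero constrained_velocity_def velocity_eq
    by (simp add: a_def power2_eq_square)
qed

text \<open>The kinetic part depends on \<open>q\<close> only through \<open>D\<close>, so an
  abstract derivative \<open>d\<close> of \<open>D\<close> covers both coordinate
  directions.\<close>

lemma hamiltonian_partial_q:
  assumes "((\<lambda>t. D (q + t *\<^sub>R axis i 1)) has_real_derivative d) (at 0)"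
  shows "partial i (\<lambda>q'. hamiltonian L a zero q' P) q
    = - (P$1)\<^sup>2 * d / (2 * m * (D q)\<^sup>2) + partial i U q"
  unfolding hamiltonian_eq
  by (rule partial_eqI)
    (auto intro!: derivative_eq_intros assms has_real_derivative_partial U_differentiable
      simp: power2_eq_square field_simps)

lemma hamiltonian_partial_P:
  "partial 1 (hamiltonian L a zero q) P = P$1 / (m * D q)"
  "partial 2 (hamiltonian L a zero q) P = P$2 / m"
  by (rule partial_eqI; auto simp: hamiltonian_eq intro!: derivative_eq_intros)+

text \<open>In the last component the first and third terms cancel; they stay separate to show what
  comes from the Hamiltonian and what from \<open>S\<close>.\<close>

lemma reduced_field_eq:
  "reduced_field L a zero (q, P) =
    (vector [P$1 / (m * D q), P$2 / m],
     vector [(P$1)\<^sup>2 * (q$1 * (q$2)\<^sup>2) / (m * (D q)\<^sup>2) - partial 1 U q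
               + P$2 * ((q$1)\<^sup>2 * q$2 * P$1) / (m * D q),
             (P$1)\<^sup>2 * ((q$1)\<^sup>2 * q$2) / (m * (D q)\<^sup>2) - partial 2 U q
               - (P$1)\<^sup>2 * ((q$1)\<^sup>2 * q$2) / (m * (D q)\<^sup>2)])"
  unfolding reduced_field_def Let_def prod.case hamiltonian_partial_P nonholonomic_S_eq
    hamiltonian_partial_q[OF D_partial_1] hamiltonian_partial_q[OF D_partial_2]
  by (intro arg_cong2[of _ _ _ _ Pair] vec2_eqI) (simp_all add: power2_eq_square)

text \<open>The term of \<open>d1\<close> that differentiates \<open>D\<close> cancels the first
  term of \<open>d3\<close>: mixed derivatives of the Hamiltonian agree. Besides the derivatives of
  \<open>N\<close>, only the \<open>P$1\<close>-derivative of \<open>P$2 * S / m\<close>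
  survives.\<close>

lemma divergence_density:
  assumes N: "\<And>q. N differentiable (at q)"
  shows "divergence (\<lambda>y. (case y of (q, P) \<Rightarrow> N q) *\<^sub>R reduced_field L a zero y) (q, P) =
    partial 1 N q * P$1 / (m * D q) + (partial 2 N q + N q * ((q$1)\<^sup>2 * q$2) / D q) * P$2 / m"
proof -
  note [derivative_intros] = has_real_derivative_partial[OF N] D_partial_1 D_partial_2
  let ?F = "\<lambda>y. (case y of (q, P) \<Rightarrow> N q) *\<^sub>R reduced_field L a zero y"
  have d1: "dir_deriv (axis 1 1, 0) (\<lambda>y. fst (?F y)$1) (q, P) =
      partial 1 N q * P$1 / (m * D q) - N q * P$1 * (2 * q$1 * (q$2)\<^sup>2) / (m * (D q)\<^sup>2)"
    by (rule dir_deriv_eqI)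
      (auto simp: reduced_field_eq power2_eq_square field_simps intro!: derivative_eq_intros)
  have d2: "dir_deriv (axis 2 1, 0) (\<lambda>y. fst (?F y)$2) (q, P) = partial 2 N q * P$2 / m"
    by (rule dir_deriv_eqI) (auto simp: reduced_field_eq intro!: derivative_eq_intros)
  have d3: "dir_deriv (0, axis 1 1) (\<lambda>y. snd (?F y)$1) (q, P) =
      N q * (2 * P$1 * (q$1 * (q$2)\<^sup>2) / (m * (D q)\<^sup>2) + P$2 * ((q$1)\<^sup>2 * q$2) / (m * D q))"
    by (rule dir_deriv_eqI) (auto simp: reduced_field_eq intro!: derivative_eq_intros)
  have d4: "dir_deriv (0, axis 2 1) (\<lambda>y. snd (?F y)$2) (q, P) = 0"
    by (rule dir_deriv_eqI) (auto simp: reduced_field_eq intro!: derivative_eq_intros)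
  show ?thesis
    unfolding divergence_phase_space d1 d2 d3 d4 by (simp add: field_simps power2_eq_square)
qed

lemma no_invariant_density:
  assumes N: "\<And>q. N differentiable (at q)" and pos: "\<And>q. N q > 0"
  shows "\<not> invariant_density (reduced_field L a zero) (\<lambda>(q, P). N q)"
proof
  assume "invariant_density (reduced_field L a zero) (\<lambda>(q, P). N q)"
  then have div: "partial 1 N q * P$1 / (m * D q)
      + (partial 2 N q + N q * ((q$1)\<^sup>2 * q$2) / D q) * P$2 / m = 0" for q and P :: "real^2"
    unfolding invariant_density_def divergence_density[OF N, symmetric] by blast
  \<comment> \<open>The divergence is linear in the momenta, so unit momenta isolate its two
    coefficients.\<close>
  have N1: "partial 1 N q = 0" for q
    using div[of q "axis 1 1"] by simp
  have N2: "partial 2 N q = - N q * ((q$1)\<^sup>2 * q$2) / D q" for q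
    using div[of q "axis 2 1"] by simp
  have shift: "N (q + axis 1 1) = N q" for q
  proof -
    have "((\<lambda>t. N (q + t *\<^sub>R axis 1 1)) has_real_derivative 0) (at s)" for s
      using has_real_derivative_along_line[of N q s "axis 1 1", OF N] N1
      by (simp add: partial_def)
    then have "N (q + 1 *\<^sub>R axis 1 1) = N (q + 0 *\<^sub>R axis 1 1)"
      using DERIV_isconst_all[of "\<lambda>t. N (q + t *\<^sub>R axis 1 1)"] by blast
    then show ?thesis by simp
  qed
  let ?q = "axis 2 1 :: real^2"
  \<comment> \<open>Equality along the entire vertical line, not just at one point, is needed to
    equate the derivatives in the second coordinate.\<close>
  have "N (?q + axis 1 1 + t *\<^sub>R axis 2 1) = N (?q + t *\<^sub>R axis 2 1)" for t
    using shift[of "?q + t *\<^sub>R axis 2 1"] by (simp add: ac_simps)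
  then have "partial 2 N (?q + axis 1 1) = partial 2 N ?q"
    by (simp add: partial_def dir_deriv_def)
  then show False
    using pos[of "?q + axis 1 1"] by (simp add: N2 D_def a_def)
qed

text \<open>The differentiated function is \<open>(q$1)\<^sup>2 * q$2 / D q\<close>, with derivative
  \<open>2 * q$1 * q$2 / (D q)\<^sup>2\<close>, evaluated at (1, 1). The vanishing terms are written
  out to match the relation with \<open>a2\<close> replaced by zero.\<close>

lemma relation_fails:
  "partial 1 (\<lambda>q. a q / (1 + (a q)\<^sup>2 + 0\<^sup>2) * (partial 2 a q - partial 1 zero q)) (axis 1 1 + axis 2 1)
    = 1/2"
  unfolding partial_a_2 partial_zero
  by (rule partial_eqI) (auto simp: a_def intro!: derivative_eq_intros)

end

theorem mainTheorem5:
  fixes m :: real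
    and U a1 a2 :: "real^2 \<Rightarrow> real"
    and L :: "real^2 \<Rightarrow> real^3 \<Rightarrow> real"
  assumes "m > 0"
    and "smooth U"
    and "L = (\<lambda>q v. 1/2 * m * ((v$1)^2 + (v$2)^2 + (v$3)^2) - U q)"
    and "a1 = (\<lambda>q. q$1 * q$2)"
    and "a2 = (\<lambda>q. 0)"
  shows "\<not> (\<forall>q.
            partial 1 (\<lambda>q. a1 q / (1 + (a1 q)^2 + (a2 q)^2) * (partial 2 a1 q - partial 1 a2 q)) q
          + partial 2 (\<lambda>q. a2 q / (1 + (a1 q)^2 + (a2 q)^2) * (partial 2 a1 q - partial 1 a2 q)) q
          = 0)
       \<and> \<not> (\<exists>N. smooth N \<and> (\<forall>q. N q > 0) \<and>
              invariant_density (reduced_field L a1 a2) (\<lambda>(q, P). N q))"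
proof -
  interpret B: blackall m U
    using assms(1,2) by unfold_locales (auto intro: smooth_imp_differentiable)
  have L: "L = B.L" and a1: "a1 = B.a"
    using assms by (auto simp: B.L_def B.a_def fun_eq_iff)
  have "partial 1 (\<lambda>q. a1 q / (1 + (a1 q)^2 + (a2 q)^2) * (partial 2 a1 q - partial 1 a2 q))
          (axis 1 1 + axis 2 1)
      + partial 2 (\<lambda>q. a2 q / (1 + (a1 q)^2 + (a2 q)^2) * (partial 2 a1 q - partial 1 a2 q))
          (axis 1 1 + axis 2 1) \<noteq> 0"
    \<comment> \<open>The second summand differentiates the zero function, so the sum is
      1/2.\<close>
    unfolding a1 \<open>a2 = (\<lambda>q. 0)\<close> B.relation_fails by (simp add: B.partial_zero)
  moreover have "\<not> invariant_density (reduced_field L a1 a2) (\<lambda>(q, P). N q)"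
    if "smooth N" "\<forall>q. N q > 0" for N
    using that B.no_invariant_density[of N]
    unfolding L a1 \<open>a2 = (\<lambda>q. 0)\<close> by (auto intro: smooth_imp_differentiable)
  ultimately show ?thesis
    by blast
qed

end
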